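(* Let $f$ be an automorphism of loxodromic type of a compact Kähler surface $X$, and let $\Omega$ be a connected component of the Fatou set of $f$. Suppose that there exist $x,y\in\Omega$ such that $f^{n_k}(x)\to y$ as $k\to+\infty$ for some sequence of integers $n_k\to\pm\infty$. Then $\Omega$ is a rotation domain, in the sense that there exists a sequence of integers $n_k\to\pm\infty$ such that $f^{n_k}\to\mathrm{id}_\Omega$ as $k\to+\infty$, uniformly on compact subsets of $\Omega$.
   Context: A compact Kähler surface is a connected compact complex manifold of dimension 2 admitting a Kähler metric. An automorphism is a biholomorphic self-map; it is of loxodromic type if the spectral radius of $f^*$ on $H^{1,1}(X;\mathbb R)$ (equivalently on $H^*(X;\mathbb{R})$) is $>1$. The Fatou set of $f$ is the largest open subset of $X$ on which $(f^n)_{n\in\mathbb Z}$ is a normal family (every sequence in $\{f^n: n\in\mathbb Z\}$ has, near each point, a subsequence converging locally uniformly). "$n_k\to\pm\infty$" means $n_k\to+\infty$ or $n_k\to-\infty$. *)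

theory Defs
  imports "HOL-Analysis.Analysis"
begin

section \<open>Maps between open subsets of coordinate spaces\<close>

definition holomorphic_vec_on :: "(complex^'n \<Rightarrow> complex^'m) \<Rightarrow> (complex^'n) set \<Rightarrow> bool" where
  "holomorphic_vec_on F U \<longleftrightarrow>
     (\<forall>z\<in>U. \<exists>D. (F has_derivative D) (at z) \<and> (\<forall>c v. D (c *s v) = c *s D v))"

primrec Ck_on :: "nat \<Rightarrow> ('v::real_normed_vector \<Rightarrow> 'w::real_normed_vector) \<Rightarrow> 'v set \<Rightarrow> bool" where
  "Ck_on 0 F U \<longleftrightarrow> continuous_on U F"
| "Ck_on (Suc k) F U \<longleftrightarrow>
     (\<forall>z\<in>U. F differentiable (at z)) \<and> (\<forall>v. Ck_on k (\<lambda>z. frechet_derivative F (at z) v) U)"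

definition smooth_on :: "('v::real_normed_vector \<Rightarrow> 'w::real_normed_vector) \<Rightarrow> 'v set \<Rightarrow> bool" where
  "smooth_on F U \<longleftrightarrow> (\<forall>k. Ck_on k F U)"


section \<open>Complex manifolds and holomorphic maps\<close>

text \<open>
  The manifold is the whole type \<open>'a\<close>; a complex structure on it is given by a (not necessarily
  maximal) holomorphic atlas. A chart is a pair of its domain and its coordinate map. The
  distance of the class \<open>metric_space\<close> plays the role of an auxiliary distance inducing the
  manifold topology (compact manifolds are metrizable); it is unrelated to the complex structure,
  and on a compact space uniform convergence does not depend on it.
\<close>

type_synonym ('a, 'n) chart = "'a set \<times> ('a \<Rightarrow> (complex, 'n) vec)"

definition chart_image :: "('a, 'n::finite) chart \<Rightarrow> (complex^'n) set" where
  "chart_image c = snd c ` fst c"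

definition chart_inv :: "('a, 'n::finite) chart \<Rightarrow> complex^'n \<Rightarrow> 'a" where
  "chart_inv c = inv_into (fst c) (snd c)"

definition coord_dom ::
    "('a \<Rightarrow> 'a) \<Rightarrow> ('a, 'n::finite) chart \<Rightarrow> ('a, 'n) chart \<Rightarrow> (complex^'n) set" where
  "coord_dom f c d = snd c ` (fst c \<inter> f -` fst d)"

definition coord_rep ::
    "('a \<Rightarrow> 'a) \<Rightarrow> ('a, 'n::finite) chart \<Rightarrow> ('a, 'n) chart \<Rightarrow> complex^'n \<Rightarrow> complex^'n" where
  "coord_rep f c d = (\<lambda>z. snd d (f (chart_inv c z)))"

definition complex_atlas :: "('a::metric_space, 'n::finite) chart set \<Rightarrow> bool" where
  "complex_atlas A \<longleftrightarrow>
     (\<Union>c\<in>A. fst c) = UNIV \<and>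
     (\<forall>c\<in>A. open (fst c) \<and> open (chart_image c) \<and>
        homeomorphism (fst c) (chart_image c) (snd c) (chart_inv c)) \<and>
     (\<forall>c\<in>A. \<forall>d\<in>A. holomorphic_vec_on (coord_rep id c d) (coord_dom id c d))"

definition holomorphic_map :: "('a::metric_space, 'n::finite) chart set \<Rightarrow> ('a \<Rightarrow> 'a) \<Rightarrow> bool" where
  "holomorphic_map A f \<longleftrightarrow> continuous_on UNIV f \<and>
     (\<forall>c\<in>A. \<forall>d\<in>A. holomorphic_vec_on (coord_rep f c d) (coord_dom f c d))"

definition automorphism :: "('a::metric_space, 'n::finite) chart set \<Rightarrow> ('a \<Rightarrow> 'a) \<Rightarrow> bool" where
  "automorphism A f \<longleftrightarrow> bij f \<and> holomorphic_map A f \<and> holomorphic_map A (inv f)"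


section \<open>Differential forms and Hermitian metrics\<close>

text \<open>
  A covariant tensor is the family of its coordinate expressions: \<open>\<beta> c z v w\<close> is the value, at the
  point with coordinates \<open>z\<close> in the chart \<open>c\<close>, on the tangent vectors with coordinates
  \<open>v\<close> and \<open>w\<close>. The expressions must agree under changes of charts; values at \<open>z\<close> outside
  \<open>chart_image c\<close> are irrelevant. All forms are real-valued.
\<close>

type_synonym ('a, 'n) field1 =
  "('a, 'n) chart \<Rightarrow> (complex, 'n) vec \<Rightarrow> (complex, 'n) vec \<Rightarrow> real"
type_synonym ('a, 'n) field2 =
  "('a, 'n) chart \<Rightarrow> (complex, 'n) vec \<Rightarrow> (complex, 'n) vec \<Rightarrow> (complex, 'n) vec \<Rightarrow> real"

definition one_form :: "('a, 'n::finite) chart set \<Rightarrow> ('a, 'n) field1 \<Rightarrow> bool" where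
  "one_form A \<theta> \<longleftrightarrow>
     (\<forall>c\<in>A. \<forall>z\<in>chart_image c. linear (\<theta> c z)) \<and>
     (\<forall>c\<in>A. \<forall>v. smooth_on (\<lambda>z. \<theta> c z v) (chart_image c)) \<and>
     (\<forall>c\<in>A. \<forall>d\<in>A. \<forall>z\<in>coord_dom id c d. \<forall>v.
        \<theta> c z v = \<theta> d (coord_rep id c d z) (frechet_derivative (coord_rep id c d) (at z) v))"

definition covariant_2_tensor :: "('a, 'n::finite) chart set \<Rightarrow> ('a, 'n) field2 \<Rightarrow> bool" where
  "covariant_2_tensor A \<beta> \<longleftrightarrow>
     (\<forall>c\<in>A. \<forall>z\<in>chart_image c. bilinear (\<beta> c z)) \<and>
     (\<forall>c\<in>A. \<forall>v w. smooth_on (\<lambda>z. \<beta> c z v w) (chart_image c)) \<and>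
     (\<forall>c\<in>A. \<forall>d\<in>A. \<forall>z\<in>coord_dom id c d. \<forall>v w.
        \<beta> c z v w = \<beta> d (coord_rep id c d z)
          (frechet_derivative (coord_rep id c d) (at z) v)
          (frechet_derivative (coord_rep id c d) (at z) w))"

definition two_form :: "('a, 'n::finite) chart set \<Rightarrow> ('a, 'n) field2 \<Rightarrow> bool" where
  "two_form A \<beta> \<longleftrightarrow>
     covariant_2_tensor A \<beta> \<and> (\<forall>c\<in>A. \<forall>z\<in>chart_image c. \<forall>v. \<beta> c z v v = 0)"

text \<open>Invariance under the complex structure; for real 2-forms this is bidegree (1,1).\<close>

definition J_invariant :: "('a, 'n::finite) chart set \<Rightarrow> ('a, 'n) field2 \<Rightarrow> bool" where
  "J_invariant A \<beta> \<longleftrightarrow>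
     (\<forall>c\<in>A. \<forall>z\<in>chart_image c. \<forall>v w. \<beta> c z (\<i> *s v) (\<i> *s w) = \<beta> c z v w)"

definition ext_deriv1 :: "('a, 'n::finite) field1 \<Rightarrow> ('a, 'n) field2" where
  "ext_deriv1 \<theta> c z v w =
     frechet_derivative (\<lambda>x. \<theta> c x w) (at z) v - frechet_derivative (\<lambda>x. \<theta> c x v) (at z) w"

definition closed_form2 :: "('a, 'n::finite) chart set \<Rightarrow> ('a, 'n) field2 \<Rightarrow> bool" where
  "closed_form2 A \<beta> \<longleftrightarrow>
     (\<forall>c\<in>A. \<forall>z\<in>chart_image c. \<forall>u v w.
        frechet_derivative (\<lambda>x. \<beta> c x v w) (at z) u
      - frechet_derivative (\<lambda>x. \<beta> c x u w) (at z) v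
      + frechet_derivative (\<lambda>x. \<beta> c x u v) (at z) w = 0)"

definition hermitian_metric :: "('a, 'n::finite) chart set \<Rightarrow> ('a, 'n) field2 \<Rightarrow> bool" where
  "hermitian_metric A g \<longleftrightarrow>
     covariant_2_tensor A g \<and> J_invariant A g \<and>
     (\<forall>c\<in>A. \<forall>z\<in>chart_image c. (\<forall>v w. g c z v w = g c z w v) \<and> (\<forall>v. v \<noteq> 0 \<longrightarrow> g c z v v > 0))"

definition fundamental_form :: "('a, 'n::finite) field2 \<Rightarrow> ('a, 'n) field2" where
  "fundamental_form g c z v w = g c z (\<i> *s v) w"

definition kahler_metric :: "('a, 'n::finite) chart set \<Rightarrow> ('a, 'n) field2 \<Rightarrow> bool" where
  "kahler_metric A g \<longleftrightarrow> hermitian_metric A g \<and> closed_form2 A (fundamental_form g)"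

definition compact_kahler_surface :: "('a::metric_space, 2) chart set \<Rightarrow> bool" where
  "compact_kahler_surface A \<longleftrightarrow>
     complex_atlas A \<and> compact (UNIV :: 'a set) \<and> connected (UNIV :: 'a set) \<and>
     (\<exists>g. kahler_metric A g)"


section \<open>The action on cohomology of bidegree (1,1) and loxodromic automorphisms\<close>

definition pullback ::
    "('a, 'n::finite) chart set \<Rightarrow> ('a \<Rightarrow> 'a) \<Rightarrow> ('a, 'n) field2 \<Rightarrow> ('a, 'n) field2" where
  "pullback A f \<beta> c z v w =
     (let d = (SOME d. d \<in> A \<and> f (chart_inv c z) \<in> fst d);
          D = frechet_derivative (coord_rep f c d) (at z)
      in \<beta> d (coord_rep f c d z) (D v) (D w))"

text \<open>
  The space of classes of closed real (1,1)-forms in real de Rham cohomology is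
  \<open>H\<^sup>1\<^sup>,\<^sup>1(X;\<real>)\<close>: elements are represented by forms satisfying \<open>closed_11\<close>, and equality
  of classes is \<open>cohomologous\<close>.
\<close>

definition closed_11 :: "('a, 'n::finite) chart set \<Rightarrow> ('a, 'n) field2 \<Rightarrow> bool" where
  "closed_11 A \<beta> \<longleftrightarrow> two_form A \<beta> \<and> J_invariant A \<beta> \<and> closed_form2 A \<beta>"

definition cohomologous ::
    "('a, 'n::finite) chart set \<Rightarrow> ('a, 'n) field2 \<Rightarrow> ('a, 'n) field2 \<Rightarrow> bool" where
  "cohomologous A \<alpha> \<beta> \<longleftrightarrow>
     (\<exists>\<theta>. one_form A \<theta> \<and>
        (\<forall>c\<in>A. \<forall>z\<in>chart_image c. \<forall>v w. \<alpha> c z v w - \<beta> c z v w = ext_deriv1 \<theta> c z v w))"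

text \<open>
  Complex eigenvalues of the real endomorphism \<open>f\<^sup>*\<close> of \<open>H\<^sup>1\<^sup>,\<^sup>1(X;\<real>)\<close>, that is, eigenvalues of
  its complexification: \<open>f\<^sup>*([\<alpha>] + \<i>[\<beta>]) = \<mu>([\<alpha>] + \<i>[\<beta>])\<close> with \<open>[\<alpha>] + \<i>[\<beta>] \<noteq> 0\<close>,
  split into real and imaginary parts.
\<close>

definition eigenvalues_H11 ::
    "('a, 'n::finite) chart set \<Rightarrow> ('a \<Rightarrow> 'a) \<Rightarrow> complex set" where
  "eigenvalues_H11 A f =
     {\<mu>. \<exists>\<alpha> \<beta>. closed_11 A \<alpha> \<and> closed_11 A \<beta> \<and>
        \<not> (cohomologous A \<alpha> (\<lambda>c z v w. 0) \<and> cohomologous A \<beta> (\<lambda>c z v w. 0)) \<and>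
        cohomologous A (pullback A f \<alpha>) (\<lambda>c z v w. Re \<mu> * \<alpha> c z v w - Im \<mu> * \<beta> c z v w) \<and>
        cohomologous A (pullback A f \<beta>) (\<lambda>c z v w. Im \<mu> * \<alpha> c z v w + Re \<mu> * \<beta> c z v w)}"

definition spectral_radius_H11 ::
    "('a, 'n::finite) chart set \<Rightarrow> ('a \<Rightarrow> 'a) \<Rightarrow> ereal" where
  "spectral_radius_H11 A f = (SUP \<mu>\<in>eigenvalues_H11 A f. ereal (cmod \<mu>))"

definition loxodromic :: "('a, 'n::finite) chart set \<Rightarrow> ('a \<Rightarrow> 'a) \<Rightarrow> bool" where
  "loxodromic A f \<longleftrightarrow> spectral_radius_H11 A f > 1"


section \<open>Iteration, Fatou set and rotation domains\<close>

definition int_iterate :: "('a \<Rightarrow> 'a) \<Rightarrow> int \<Rightarrow> 'a \<Rightarrow> 'a" where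
  "int_iterate f n = (if n \<ge> 0 then f ^^ nat n else inv f ^^ nat (- n))"

definition tends_to_pm_infinity :: "(nat \<Rightarrow> int) \<Rightarrow> bool" where
  "tends_to_pm_infinity n \<longleftrightarrow>
     filterlim n at_top sequentially \<or> filterlim n at_bot sequentially"

definition converges_compactly_on ::
    "'a::metric_space set \<Rightarrow> (nat \<Rightarrow> 'a \<Rightarrow> 'a) \<Rightarrow> ('a \<Rightarrow> 'a) \<Rightarrow> bool" where
  "converges_compactly_on U F h \<longleftrightarrow>
     (\<forall>K. compact K \<and> K \<subseteq> U \<longrightarrow> uniform_limit K F h sequentially)"

definition normal_family_on :: "'a::metric_space set \<Rightarrow> ('a \<Rightarrow> 'a) set \<Rightarrow> bool" where
  "normal_family_on U \<F> \<longleftrightarrow>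
     (\<forall>F::nat \<Rightarrow> 'a \<Rightarrow> 'a. range F \<subseteq> \<F> \<longrightarrow>
        (\<forall>x\<in>U. \<exists>V r h. open V \<and> x \<in> V \<and> V \<subseteq> U \<and> strict_mono (r :: nat \<Rightarrow> nat) \<and>
           converges_compactly_on V (F \<circ> r) h))"

definition fatou_set :: "('a::metric_space \<Rightarrow> 'a) \<Rightarrow> 'a set" where
  "fatou_set f = \<Union>{U. open U \<and> normal_family_on U (range (int_iterate f))}"

lemma fatou_set_is_largest:
  fixes f :: "'a::metric_space \<Rightarrow> 'a"
  shows "open (fatou_set f)"
    and "normal_family_on (fatou_set f) (range (int_iterate f))"
    and "\<And>U. open U \<Longrightarrow> normal_family_on U (range (int_iterate f)) \<Longrightarrow> U \<subseteq> fatou_set f"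
proof -
  show "open (fatou_set f)" unfolding fatou_set_def by blast
  show "U \<subseteq> fatou_set f" if "open U" "normal_family_on U (range (int_iterate f))" for U
    using that unfolding fatou_set_def by blast
  show "normal_family_on (fatou_set f) (range (int_iterate f))"
    unfolding normal_family_on_def
  proof (intro allI impI ballI)
    fix F :: "nat \<Rightarrow> 'a \<Rightarrow> 'a" and x
    assume F: "range F \<subseteq> range (int_iterate f)" and "x \<in> fatou_set f"
    then obtain U where U: "open U" "normal_family_on U (range (int_iterate f))" "x \<in> U"
      unfolding fatou_set_def by blast
    then have "U \<subseteq> fatou_set f" unfolding fatou_set_def by blast
    moreover obtain V r h where "open V" "x \<in> V" "V \<subseteq> U" "strict_mono (r :: nat \<Rightarrow> nat)"
      "converges_compactly_on V (F \<circ> r) h"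
      using U(2,3) F unfolding normal_family_on_def by meson
    ultimately show "\<exists>V r h. open V \<and> x \<in> V \<and> V \<subseteq> fatou_set f \<and> strict_mono (r :: nat \<Rightarrow> nat) \<and>
        converges_compactly_on V (F \<circ> r) h"
      by blast
  qed
qed

definition rotation_domain :: "('a::metric_space \<Rightarrow> 'a) \<Rightarrow> 'a set \<Rightarrow> bool" where
  "rotation_domain f \<Omega> \<longleftrightarrow>
     (\<exists>n. tends_to_pm_infinity n \<and>
        converges_compactly_on \<Omega> (\<lambda>k. int_iterate f (n k)) (\<lambda>z. z))"

end

theory Submission
  imports Defs "HOL-Complex_Analysis.Great_Picard"
begin

text \<open>
  Normality of all iterates, positive and negative, makes them equicontinuous on the Fatou set.
  After passing to a subsequence, the maps \<open>f\<^bsup>n\<^sub>k\<^esup>\<close> are uniformly Cauchy near \<open>x\<close>, while the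
  maps \<open>f\<^bsup>-n\<^sub>k\<^esup>\<close> send a fixed neighbourhood of \<open>y\<close> close to \<open>x\<close>; so
  \<open>f\<^bsup>n\<^sub>j - n\<^sub>k\<^esup>\<close> tends to the identity near \<open>y\<close> as \<open>j, k\<close> grow, and \<open>j\<close> can be taken so much
  larger than \<open>k\<close> that the exponents diverge. By Montel's theorem and analytic continuation, the
  open set on which these maps converge to the identity is relatively closed in the Fatou set,
  hence it contains the whole component.
\<close>

section \<open>Integer iterates as a group action\<close>

lemma int_iterate_0: "int_iterate f 0 = id"
  by (simp add: int_iterate_def)

lemma int_iterate_step:
  assumes "bij f"
  shows "int_iterate f (n + 1) x = f (int_iterate f n x)"
proof (cases "n \<ge> 0")
  case True
  then show ?thesis
    by (simp add: int_iterate_def nat_add_distrib)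
next
  case False
  then have "nat (- n) = Suc (nat (- (n + 1)))" by simp
  then have "int_iterate f n x = inv f ((inv f ^^ nat (- (n + 1))) x)"
    using False by (simp add: int_iterate_def)
  moreover have "int_iterate f (n + 1) x = (inv f ^^ nat (- (n + 1))) x"
    using False by (cases "n = - 1") (simp_all add: int_iterate_def)
  ultimately show ?thesis
    using assms by (simp add: bij_is_surj surj_f_inv_f)
qed

lemma int_iterate_add:
  assumes "bij f"
  shows "int_iterate f (m + n) x = int_iterate f m (int_iterate f n x)"
proof (induction m rule: int_induct[where k = 0])
  case base
  show ?case by (simp add: int_iterate_0)
next
  case (step1 i)
  then show ?case
    using int_iterate_step[OF assms, of "i + n"] int_iterate_step[OF assms, of i]
    by (simp add: algebra_simps)
next
  case (step2 i)
  \<comment> \<open>Going down, both sides are compared after one more application of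
    \<open>f\<close>, because \<open>int_iterate_step\<close> only moves upwards; injectivity of
    \<open>f\<close> then removes it.\<close>
  have "f (int_iterate f (i - 1 + n) x) = f (int_iterate f (i - 1) (int_iterate f n x))"
    using step2 int_iterate_step[OF assms, of "i - 1 + n"] int_iterate_step[OF assms, of "i - 1"]
    by (simp add: algebra_simps)
  then show ?case
    using assms by (simp add: bij_is_inj inj_eq)
qed

lemma int_iterate_cancel:
  assumes "bij f"
  shows "int_iterate f n (int_iterate f (- n) x) = x" "int_iterate f (- n) (int_iterate f n x) = x"
  using int_iterate_add[OF assms, of n "- n" x] int_iterate_add[OF assms, of "- n" n x]
  by (simp_all add: int_iterate_0)


section \<open>Holomorphic maps in charts\<close>

lemma holomorphic_vec_on_subset:
  "holomorphic_vec_on F U \<Longrightarrow> V \<subseteq> U \<Longrightarrow> holomorphic_vec_on F V"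
  unfolding holomorphic_vec_on_def by blast

lemma holomorphic_vec_on_id: "holomorphic_vec_on (\<lambda>z. z) U"
  unfolding holomorphic_vec_on_def by (blast intro: has_derivative_ident)

context
  fixes A :: "('a::metric_space, 'n::finite) chart set"
  assumes A: "complex_atlas A"
begin

lemma chart_open: "c \<in> A \<Longrightarrow> open (fst c)" "c \<in> A \<Longrightarrow> open (chart_image c)"
  using A by (auto simp: complex_atlas_def)

lemma chart_exists: "\<exists>c\<in>A. x \<in> fst c"
  using A unfolding complex_atlas_def by blast

lemma chart_homeomorphism:
  "c \<in> A \<Longrightarrow> homeomorphism (fst c) (chart_image c) (snd c) (chart_inv c)"
  using A by (auto simp: complex_atlas_def)

lemma chart_inv_chart: "c \<in> A \<Longrightarrow> x \<in> fst c \<Longrightarrow> chart_inv c (snd c x) = x"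
  using chart_homeomorphism homeomorphism_apply1 by fastforce

lemma chart_chart_inv:
  assumes "c \<in> A" "z \<in> chart_image c"
  shows "snd c (chart_inv c z) = z" "chart_inv c z \<in> fst c"
  using chart_homeomorphism[OF assms(1)] assms(2)
  by (auto simp: homeomorphism_def)

text \<open>Replacing the image under the chart by a preimage under \<open>chart_inv\<close> makes
  openness of this set a matter of continuity.\<close>

lemma coord_dom_eq:
  assumes "c \<in> A"
  shows "coord_dom f c d = {z \<in> chart_image c. f (chart_inv c z) \<in> fst d}"
  using chart_inv_chart[OF assms] chart_chart_inv[OF assms]
  by (force simp: coord_dom_def chart_image_def)

lemma open_chart_inv_vimage:
  assumes "c \<in> A" "open V"
  shows "open {z \<in> chart_image c. chart_inv c z \<in> V}"
proof -
  have "continuous_on (chart_image c) (chart_inv c)"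
    using chart_homeomorphism[OF assms(1)] by (simp add: homeomorphism_def)
  then have "open (chart_image c \<inter> chart_inv c -` V)"
    using chart_open assms by (simp add: continuous_on_open_vimage Int_commute)
  then show ?thesis by (simp add: vimage_def Int_def)
qed

lemma open_coord_dom:
  assumes "c \<in> A" "d \<in> A" "continuous_on UNIV f"
  shows "open (coord_dom f c d)"
proof -
  have "open (f -` fst d)"
    using assms chart_open by (intro open_vimage) auto
  from open_chart_inv_vimage[OF assms(1) this] show ?thesis
    by (simp add: coord_dom_eq[OF assms(1)])
qed

lemma holomorphic_map_id: "holomorphic_map A id"
  using A by (auto simp: holomorphic_map_def complex_atlas_def)

text \<open>This is the chain rule through a chart \<open>d\<close> around the image point, chosen
  anew for each point. The coordinate expressions are only known to compose on
  \<open>coord_dom f c d\<close>, which suffices for derivatives because this set is open.\<close>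

lemma holomorphic_map_comp:
  assumes f: "holomorphic_map A f" and g: "holomorphic_map A g"
  shows "holomorphic_map A (g \<circ> f)"
  unfolding holomorphic_map_def
proof (intro conjI ballI)
  have cf: "continuous_on UNIV f" and cg: "continuous_on UNIV g"
    using f g by (auto simp: holomorphic_map_def)
  show "continuous_on UNIV (g \<circ> f)"
    by (rule continuous_on_compose[OF cf continuous_on_subset[OF cg]]) simp
  fix c e assume c: "c \<in> A" and e: "e \<in> A"
  show "holomorphic_vec_on (coord_rep (g \<circ> f) c e) (coord_dom (g \<circ> f) c e)"
    unfolding holomorphic_vec_on_def
  proof
    fix z assume "z \<in> coord_dom (g \<circ> f) c e"
    then have z: "z \<in> chart_image c" "g (f (chart_inv c z)) \<in> fst e"
      by (simp_all add: coord_dom_eq[OF c])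
    obtain d where d: "d \<in> A" "f (chart_inv c z) \<in> fst d"
      using chart_exists by blast
    let ?F = "coord_rep f c d" and ?G = "coord_rep g d e"
    have zF: "z \<in> coord_dom f c d"
      using z d by (simp add: coord_dom_eq[OF c])
    have zG: "?F z \<in> coord_dom g d e"
      using z d chart_inv_chart[OF d] by (auto simp: coord_dom_def coord_rep_def)
    obtain D where D: "(?F has_derivative D) (at z)" "\<And>r v. D (r *s v) = r *s D v"
      using f c d zF unfolding holomorphic_map_def holomorphic_vec_on_def by meson
    obtain E where E: "(?G has_derivative E) (at (?F z))" "\<And>r v. E (r *s v) = r *s E v"
      using g d e zG unfolding holomorphic_map_def holomorphic_vec_on_def by meson
    have "((?G \<circ> ?F) has_derivative (E \<circ> D)) (at z)"
      using diff_chain_at[OF D(1) E(1)] .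
    then have "(coord_rep (g \<circ> f) c e has_derivative (E \<circ> D)) (at z)"
    proof (rule has_derivative_transform_within_open)
      show "open (coord_dom f c d)"
        using open_coord_dom[OF c d(1) cf] .
      show "z \<in> coord_dom f c d" by (rule zF)
      show "(?G \<circ> ?F) w = coord_rep (g \<circ> f) c e w" if "w \<in> coord_dom f c d" for w
        using that chart_inv_chart[OF d(1)] by (simp add: coord_dom_eq[OF c] coord_rep_def)
    qed
    then show "\<exists>D. (coord_rep (g \<circ> f) c e has_derivative D) (at z) \<and> (\<forall>r v. D (r *s v) = r *s D v)"
      using D(2) E(2) by (intro exI[of _ "E \<circ> D"]) simp
  qed
qed

lemma holomorphic_map_funpow:
  assumes "holomorphic_map A f"
  shows "holomorphic_map A (f ^^ k)"
proof (induction k)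
  case 0
  show ?case using holomorphic_map_id by (simp add: id_def)
next
  case (Suc k)
  show ?case using holomorphic_map_comp[OF Suc assms] by (simp only: funpow.simps)
qed

lemma holomorphic_map_int_iterate:
  assumes "automorphism A f"
  shows "holomorphic_map A (int_iterate f n)"
  using assms holomorphic_map_funpow by (simp add: automorphism_def int_iterate_def)

end


section \<open>Vitali's convergence principle\<close>

text \<open>If the limit failed, infinitely many terms would avoid some neighbourhood of
  \<open>l\<close>; enumerating them gives a subsequence with no further subsequence tending to
  \<open>l\<close>.\<close>

lemma tendsto_if_subseq_tendsto:
  fixes X :: "nat \<Rightarrow> 'a::topological_space"
  assumes "\<And>r. strict_mono (r :: nat \<Rightarrow> nat) \<Longrightarrow> \<exists>s. strict_mono (s :: nat \<Rightarrow> nat) \<and> (X \<circ> r \<circ> s) \<longlonglongrightarrow> l"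
  shows "X \<longlonglongrightarrow> l"
proof (rule topological_tendstoI, rule ccontr)
  fix S assume S: "open S" "l \<in> S" and "\<not> (\<forall>\<^sub>F k in sequentially. X k \<in> S)"
  then have "infinite {k. X k \<notin> S}"
    by (simp add: eventually_cofinite flip: cofinite_eq_sequentially)
  then obtain r :: "nat \<Rightarrow> nat" where r: "strict_mono r" "\<And>k. X (r k) \<notin> S"
    using infinite_enumerate by (metis mem_Collect_eq)
  obtain s :: "nat \<Rightarrow> nat" where "(X \<circ> r \<circ> s) \<longlonglongrightarrow> l"
    using assms[OF r(1)] by blast
  then have "\<forall>\<^sub>F k in sequentially. (X \<circ> r \<circ> s) k \<in> S"
    by (rule topological_tendstoD) (use S in auto)
  then show False using r(2) by (simp add: trivial_limit_sequentially)
qed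

text \<open>By Montel's theorem every subsequence has a further one with a holomorphic limit. This
  limit vanishes on \<open>U\<close>, hence on the connected set \<open>T\<close> by the identity
  theorem, so all subsequential limits are 0.\<close>

lemma holomorphic_tendsto_0_continuation:
  fixes g :: "nat \<Rightarrow> complex \<Rightarrow> complex"
  assumes "open T" "connected T"
    and hol: "\<And>k. g k holomorphic_on T"
    and bound: "\<And>k t. t \<in> T \<Longrightarrow> cmod (g k t) \<le> M"
    and U: "open U" "U \<noteq> {}" "U \<subseteq> T"
    and lim: "\<And>t. t \<in> U \<Longrightarrow> (\<lambda>k. g k t) \<longlonglongrightarrow> 0"
    and "t \<in> T"
  shows "(\<lambda>k. g k t) \<longlonglongrightarrow> 0"
proof (rule tendsto_if_subseq_tendsto)
  fix r :: "nat \<Rightarrow> nat" assume r: "strict_mono r"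
  obtain h s where h: "h holomorphic_on T" and s: "strict_mono (s :: nat \<Rightarrow> nat)"
    and conv: "\<And>t. t \<in> T \<Longrightarrow> (\<lambda>k. (g \<circ> r) (s k) t) \<longlonglongrightarrow> h t"
  proof (rule Montel[of T "range g" "g \<circ> r"])
    show "\<exists>B. \<forall>h\<in>range g. \<forall>z\<in>K. cmod (h z) \<le> B" if "K \<subseteq> T" for K
      using bound that by blast
  qed (use \<open>open T\<close> hol in auto)
  have "h u = 0" if "u \<in> U" for u
  proof (rule LIMSEQ_unique)
    show "(\<lambda>k. g (r (s k)) u) \<longlonglongrightarrow> h u"
      using conv U that by auto
    show "(\<lambda>k. g (r (s k)) u) \<longlonglongrightarrow> 0"
      using LIMSEQ_subseq_LIMSEQ[OF lim[OF that] strict_mono_o[OF r s]]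
      by (simp add: o_def)
  qed
  then have "h t = 0"
    using analytic_continuation_open[of U T h "\<lambda>_. 0" t] assms h by simp
  then show "\<exists>s. strict_mono (s :: nat \<Rightarrow> nat) \<and> ((\<lambda>k. g k t) \<circ> r \<circ> s) \<longlonglongrightarrow> 0"
    using s conv[OF \<open>t \<in> T\<close>] by (auto simp: o_def)
qed

lemma has_derivative_complex_line:
  fixes a v :: "complex^'n::finite"
  shows "((\<lambda>t. a + t *s v) has_derivative (\<lambda>t. t *s v)) (at t)"
proof -
  have "bounded_linear (\<lambda>t. t *s v)"
    by (intro linear_conv_bounded_linear[THEN iffD1] linearI)
      (simp_all add: vec_eq_iff algebra_simps)
  then show ?thesis
    by (auto intro!: derivative_eq_intros bounded_linear_imp_has_derivative)
qed

text \<open>Complex linearity of \<open>D\<close> gives \<open>D (t *s v) $ i = t * D v $ i\<close>,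
  so the real derivative along a complex line is multiplication by a complex number.\<close>

lemma holomorphic_vec_on_line:
  fixes F :: "complex^'n::finite \<Rightarrow> complex^'m::finite"
  assumes F: "holomorphic_vec_on F B" and T: "\<And>t. t \<in> T \<Longrightarrow> a + t *s v \<in> B"
  shows "(\<lambda>t. F (a + t *s v) $ i) holomorphic_on T"
  unfolding holomorphic_on_def field_differentiable_def
proof
  fix t assume "t \<in> T"
  then obtain D where D: "(F has_derivative D) (at (a + t *s v))" "\<And>r v. D (r *s v) = r *s D v"
    using F T unfolding holomorphic_vec_on_def by meson
  have "((\<lambda>t. F (a + t *s v)) has_derivative (\<lambda>t. D (t *s v))) (at t)"
    using diff_chain_at[OF has_derivative_complex_line D(1)] by (simp add: o_def)
  then have "((\<lambda>t. F (a + t *s v) $ i) has_derivative (\<lambda>t. D (t *s v) $ i)) (at t)"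
    by (rule bounded_linear.has_derivative[OF bounded_linear_vec_nth])
  moreover have "(\<lambda>t. D (t *s v) $ i) = (*) (D v $ i)"
    by (auto simp: D(2))
  ultimately have "((\<lambda>t. F (a + t *s v) $ i) has_field_derivative D v $ i) (at t)"
    by (simp add: has_field_derivative_def)
  then show "\<exists>d. ((\<lambda>t. F (a + t *s v) $ i) has_field_derivative d) (at t within T)"
    by (blast intro: has_field_derivative_at_within)
qed

text \<open>Joining two points of the ball by a complex line reduces this to one variable.\<close>

lemma holomorphic_vec_tendsto_ident_continuation:
  fixes F :: "nat \<Rightarrow> complex^'n::finite \<Rightarrow> complex^'n"
  assumes hol: "\<And>k. holomorphic_vec_on (F k) (ball p \<rho>)"
    and bound: "\<And>k z. z \<in> ball p \<rho> \<Longrightarrow> norm (F k z) \<le> M"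
    and U: "open U" "U \<subseteq> ball p \<rho>" "U \<noteq> {}"
    and lim: "\<And>z. z \<in> U \<Longrightarrow> (\<lambda>k. F k z) \<longlonglongrightarrow> z"
    and b: "b \<in> ball p \<rho>"
  shows "(\<lambda>k. F k b) \<longlonglongrightarrow> b"
proof (rule vec_tendstoI)
  fix i
  obtain a where a: "a \<in> U" using U by blast
  \<comment> \<open>With this direction the parameters 0 and 1 of the line \<open>?L\<close>
    correspond to \<open>a\<close> and \<open>b\<close>.\<close>
  define v where "v = b - a"
  let ?L = "\<lambda>t::complex. a + t *s v"
  define T where "T = ?L -` ball p \<rho>"
  let ?g = "\<lambda>k t. F k (?L t) $ i - ?L t $ i"
  have cont: "continuous_on UNIV ?L"
    using has_derivative_complex_line[of a v]
    by (meson continuous_at_imp_continuous_on has_derivative_continuous)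
  have "open T"
    unfolding T_def by (rule open_vimage[OF open_ball cont])
  have "convex T"
  proof (rule convexI)
    fix s t :: complex and x y :: real
    assume st: "s \<in> T" "t \<in> T" and xy: "0 \<le> x" "0 \<le> y" "x + y = 1"
    have "?L (x *\<^sub>R s + y *\<^sub>R t) = x *\<^sub>R ?L s + y *\<^sub>R ?L t"
    proof -
      have "a = x *\<^sub>R a + y *\<^sub>R a"
        using xy by (simp flip: scaleR_add_left)
      then show ?thesis
        by (simp add: vec_eq_iff algebra_simps)
    qed
    then show "x *\<^sub>R s + y *\<^sub>R t \<in> T"
      using st xy convexD[OF convex_ball, of "?L s" p \<rho> "?L t" x y] by (simp add: T_def)
  qed
  have "(\<lambda>k. ?g k 1) \<longlonglongrightarrow> 0"
  \<comment> \<open>In the bound, \<open>M\<close> controls \<open>F k\<close>, and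
    \<open>norm p + \<rho>\<close> controls the identity, which is subtracted to make the limit
    0.\<close>
  proof (rule holomorphic_tendsto_0_continuation[of T ?g "M + (norm p + \<rho>)" "?L -` U"])
    show "open T" by fact
    show "connected T" using \<open>convex T\<close> by (rule convex_connected)
    show "?g k holomorphic_on T" for k
      using holomorphic_vec_on_line[OF hol, of T a v] holomorphic_vec_on_line[OF holomorphic_vec_on_id[of UNIV], of T a v]
      by (intro holomorphic_on_diff) (auto simp: T_def)
    show "cmod (?g k t) \<le> M + (norm p + \<rho>)" if "t \<in> T" for k t
    proof -
      have t: "?L t \<in> ball p \<rho>" using that by (simp add: T_def)
      have "cmod (?g k t) \<le> cmod (F k (?L t) $ i) + cmod (?L t $ i)"
        by (rule norm_triangle_ineq4)
      also have "\<dots> \<le> norm (F k (?L t)) + norm (?L t)"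
        by (intro add_mono Finite_Cartesian_Product.norm_nth_le)
      also have "\<dots> \<le> M + (norm p + \<rho>)"
        using bound[OF t, of k] t norm_triangle_sub[of "?L t" p]
        by (simp add: dist_norm norm_minus_commute)
      finally show ?thesis .
    qed
    show "open (?L -` U)" by (rule open_vimage[OF U(1) cont])
    show "?L -` U \<noteq> {}"
    proof -
      have "0 \<in> ?L -` U" using a by simp
      then show ?thesis by blast
    qed
    show "?L -` U \<subseteq> T" using U by (auto simp: T_def)
    show "(\<lambda>k. ?g k t) \<longlonglongrightarrow> 0" if "t \<in> ?L -` U" for t
      using tendsto_vec_nth[OF lim[of "?L t"], of i] that by (auto simp: LIM_zero)
    show "1 \<in> T" using b by (simp add: T_def v_def)
  qed
  then show "(\<lambda>k. F k b $ i) \<longlonglongrightarrow> b $ i"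
    by (simp add: v_def LIM_zero_iff)
qed


section \<open>Equicontinuity and recurrence\<close>

text \<open>With integers as indices, one \<delta> serves all iterates at once, hence any sequence
  of exponents formed later.\<close>

definition equicontinuous_at :: "('i \<Rightarrow> 'a::metric_space \<Rightarrow> 'a) \<Rightarrow> 'a \<Rightarrow> bool" where
  "equicontinuous_at F z \<longleftrightarrow> (\<forall>\<epsilon>>0. \<exists>\<delta>>0. \<forall>i w. dist w z < \<delta> \<longrightarrow> dist (F i w) (F i z) < \<epsilon>)"

lemma equicontinuous_atE:
  assumes "equicontinuous_at F z" "\<epsilon> > 0"
  obtains \<delta> where "\<delta> > 0" "\<And>i w. dist w z < \<delta> \<Longrightarrow> dist (F i w) (F i z) < \<epsilon>"
  using assms unfolding equicontinuous_at_def by meson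

lemma compact_cball_compact_space:
  assumes "compact (UNIV :: 'a::metric_space set)"
  shows "compact (cball (x :: 'a) r)"
  using compact_Int_closed[OF assms closed_cball] by simp

text \<open>This is one half of the Arzela-Ascoli theorem. Points \<open>w k\<close> tending to
  \<open>z\<close> that violate equicontinuity are followed along a uniformly convergent
  subsequence; its limit is continuous at \<open>z\<close>, and a three-term estimate gives a
  contradiction.\<close>

lemma normal_family_imp_equicontinuous_at:
  fixes F :: "'i \<Rightarrow> 'a::metric_space \<Rightarrow> 'a"
  assumes comp: "compact (UNIV :: 'a set)"
    and normal: "normal_family_on U (range F)" and z: "z \<in> U"
    and cont: "\<And>i. continuous_on UNIV (F i)"
  shows "equicontinuous_at F z"
proof (rule ccontr)
  assume "\<not> equicontinuous_at F z"
  then obtain \<epsilon> where \<epsilon>: "\<epsilon> > 0"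
    and "\<And>\<delta>. \<delta> > 0 \<Longrightarrow> \<exists>i w. dist w z < \<delta> \<and> \<epsilon> \<le> dist (F i w) (F i z)"
    unfolding equicontinuous_at_def by (meson not_le)
  then have "\<forall>k. \<exists>i w. dist w z < inverse (real (Suc k)) \<and> \<epsilon> \<le> dist (F i w) (F i z)"
    by simp
  then obtain i w where w: "\<And>k. dist (w k) z < inverse (real (Suc k))"
    and far: "\<And>k. \<epsilon> \<le> dist (F (i k) (w k)) (F (i k) z)"
    by metis
  obtain V r h where V: "open V" "z \<in> V" and r: "strict_mono (r :: nat \<Rightarrow> nat)"
    and conv: "converges_compactly_on V ((\<lambda>k. F (i k)) \<circ> r) h"
    using normal z unfolding normal_family_on_def
    by (metis (no_types, lifting) image_subset_iff rangeI)
  obtain e where e: "e > 0" "cball z e \<subseteq> V"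
    using V open_contains_cball by blast
  let ?K = "cball z e"
  have lim: "uniform_limit ?K ((\<lambda>k. F (i k)) \<circ> r) h sequentially"
    using conv e compact_cball_compact_space[OF comp] by (auto simp: converges_compactly_on_def)
  then have "continuous_on ?K h"
    by (rule uniform_limit_theorem[rotated])
      (auto intro!: always_eventually continuous_on_subset[OF cont])
  moreover have "z \<in> ?K" using e by simp
  ultimately obtain d where d: "d > 0" "\<And>u. u \<in> ?K \<Longrightarrow> dist u z < d \<Longrightarrow> dist (h u) (h z) < \<epsilon> / 3"
    using \<epsilon> unfolding continuous_on_iff by (metis divide_pos_pos zero_less_numeral)
  have "\<forall>\<^sub>F k in sequentially. \<forall>u\<in>?K. dist (F (i (r k)) u) (h u) < \<epsilon> / 3"
    using uniform_limitD[OF lim, of "\<epsilon> / 3"] \<epsilon> by simp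
  moreover have "\<forall>\<^sub>F k in sequentially. inverse (real (Suc k)) < min d e"
    using LIMSEQ_inverse_real_of_nat d e by (intro order_tendstoD) auto
  then have "\<forall>\<^sub>F k in sequentially. inverse (real (Suc (r k))) < min d e"
    using r by (rule eventually_subseq[rotated])
  ultimately have "\<forall>\<^sub>F k in sequentially. False"
  proof eventually_elim
    case (elim k)
    have wk: "dist (w (r k)) z < min d e"
      using w[of "r k"] elim(2) by linarith
    then have "w (r k) \<in> ?K" by (simp add: dist_commute)
    moreover have "dist (h (w (r k))) (h z) < \<epsilon> / 3"
      using d wk calculation by simp
    ultimately have "dist (F (i (r k)) (w (r k))) (F (i (r k)) z) < \<epsilon>"
      using elim(1) \<open>z \<in> ?K\<close>
        dist_triangle_third[of "F (i (r k)) (w (r k))" "h (w (r k))" \<epsilon> "h z" "F (i (r k)) z"]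
      by (simp add: dist_commute)
    then show False using far[of "r k"] by simp
  qed
  then show False by simp
qed

lemma fatou_equicontinuous_at:
  fixes A :: "('a::metric_space, 'n::finite) chart set"
  assumes "complex_atlas A" "compact (UNIV :: 'a set)" "automorphism A f" "z \<in> fatou_set f"
  shows "equicontinuous_at (int_iterate f) z"
  using assms holomorphic_map_int_iterate[OF assms(1,3)]
  by (intro normal_family_imp_equicontinuous_at[OF _ fatou_set_is_largest(2)])
    (auto simp: holomorphic_map_def)

text \<open>Finitely many equicontinuity balls cover \<open>K\<close>, and pointwise convergence at
  their centres is uniform because there are finitely many of them.\<close>

lemma equicontinuous_tendsto_ident_uniform:
  fixes F :: "'i \<Rightarrow> 'a::metric_space \<Rightarrow> 'a" and m :: "nat \<Rightarrow> 'i"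
  assumes eq: "\<And>z. z \<in> K \<Longrightarrow> equicontinuous_at F z"
    and lim: "\<And>z. z \<in> K \<Longrightarrow> (\<lambda>k. F (m k) z) \<longlonglongrightarrow> z" and "compact K"
  shows "uniform_limit K (\<lambda>k. F (m k)) (\<lambda>z. z) sequentially"
proof (rule uniform_limitI)
  fix \<epsilon> :: real assume \<epsilon>: "\<epsilon> > 0"
  \<comment> \<open>The cap \<epsilon>/3 is needed because the limit map is the identity: its own
    variation between \<open>w\<close> and \<open>z\<close> is the third error term.\<close>
  have "\<exists>\<delta>>0. \<delta> \<le> \<epsilon> / 3 \<and> (\<forall>i w. dist w z < \<delta> \<longrightarrow> dist (F i w) (F i z) < \<epsilon> / 3)" if z: "z \<in> K" for z
  proof -
    obtain \<delta> where "\<delta> > 0" "\<And>i w. dist w z < \<delta> \<Longrightarrow> dist (F i w) (F i z) < \<epsilon> / 3"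
      using equicontinuous_atE[OF eq[OF z], of "\<epsilon> / 3"] \<epsilon> by auto
    then show ?thesis using \<epsilon> by (intro exI[of _ "min \<delta> (\<epsilon> / 3)"]) auto
  qed
  then obtain \<delta> where \<delta>: "\<And>z. z \<in> K \<Longrightarrow> \<delta> z > 0" "\<And>z. z \<in> K \<Longrightarrow> \<delta> z \<le> \<epsilon> / 3"
    "\<And>z i w. z \<in> K \<Longrightarrow> dist w z < \<delta> z \<Longrightarrow> dist (F i w) (F i z) < \<epsilon> / 3"
    by metis
  obtain C where C: "C \<subseteq> K" "finite C" "K \<subseteq> (\<Union>z\<in>C. ball z (\<delta> z))"
  proof (rule compactE_image[OF \<open>compact K\<close>])
    show "K \<subseteq> (\<Union>z\<in>K. ball z (\<delta> z))" using \<delta>(1) by force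
  qed auto
  have "\<forall>\<^sub>F k in sequentially. \<forall>z\<in>C. dist (F (m k) z) z < \<epsilon> / 3"
  proof (intro eventually_ball_finite ballI tendstoD)
    show "(\<lambda>k. F (m k) z) \<longlonglongrightarrow> z" if "z \<in> C" for z
      using lim C that by blast
  qed (use C \<epsilon> in auto)
  then show "\<forall>\<^sub>F k in sequentially. \<forall>w\<in>K. dist (F (m k) w) w < \<epsilon>"
  proof eventually_elim
    case (elim k)
    show ?case
    proof
      fix w assume "w \<in> K"
      then obtain z where z: "z \<in> C" "dist w z < \<delta> z"
        using C(3) by (auto simp: dist_commute)
      then show "dist (F (m k) w) w < \<epsilon>"
        using dist_triangle_third[of "F (m k) w" "F (m k) z" \<epsilon> z w] \<delta>(2)[of z] \<delta>(3)[of z w] C(1) elim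
        by (force simp: dist_commute)
    qed
  qed
qed

text \<open>A single nearby point of convergence \<open>w\<close> suffices: equicontinuity compares
  \<open>F (m k) z\<close> with \<open>F (m k) w\<close>, which is eventually close to
  \<open>w\<close> and so to \<open>z\<close>.\<close>

lemma equicontinuous_tendsto_ident_closed:
  fixes F :: "'i \<Rightarrow> 'a::metric_space \<Rightarrow> 'a" and m :: "nat \<Rightarrow> 'i"
  assumes eq: "equicontinuous_at F z" and z: "z \<in> closure {w. (\<lambda>k. F (m k) w) \<longlonglongrightarrow> w}"
  shows "(\<lambda>k. F (m k) z) \<longlonglongrightarrow> z"
proof (rule tendstoI)
  fix \<epsilon> :: real assume \<epsilon>: "\<epsilon> > 0"
  obtain \<delta> where \<delta>: "\<delta> > 0" "\<And>i w. dist w z < \<delta> \<Longrightarrow> dist (F i w) (F i z) < \<epsilon> / 3"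
    using equicontinuous_atE[OF eq, of "\<epsilon> / 3"] \<epsilon> by auto
  obtain w where w: "(\<lambda>k. F (m k) w) \<longlonglongrightarrow> w" "dist w z < min \<delta> (\<epsilon> / 3)"
    using z \<delta> \<epsilon> unfolding closure_approachable
    by (metis (no_types, lifting) divide_pos_pos mem_Collect_eq min_less_iff_conj zero_less_numeral)
  have "\<forall>\<^sub>F k in sequentially. dist (F (m k) w) w < \<epsilon> / 3"
    using w \<epsilon> by (intro tendstoD) auto
  then show "\<forall>\<^sub>F k in sequentially. dist (F (m k) z) z < \<epsilon>"
  proof eventually_elim
    case (elim k)
    then show ?case
      using dist_triangle_third[of "F (m k) z" "F (m k) w" \<epsilon> w z] \<delta>(2)[of w "m k"] w(2)
      by (simp add: dist_commute)
  qed
qed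

text \<open>
  The points \<open>f\<^bsup>-n\<^sub>k\<^esup> w\<close> stay near \<open>x\<close>, where \<open>f\<^bsup>n\<^sub>j\<^esup>\<close> and \<open>f\<^bsup>n\<^sub>k\<^esup>\<close> are uniformly close.
\<close>

lemma recurrent_differences:
  fixes f :: "'a::metric_space \<Rightarrow> 'a"
  assumes comp: "compact (UNIV :: 'a set)" and "bij f"
    and x: "x \<in> fatou_set f" and eq: "equicontinuous_at (int_iterate f) y"
    and lim: "(\<lambda>k. int_iterate f (n k) x) \<longlonglongrightarrow> y"
  obtains r :: "nat \<Rightarrow> nat" and \<eta> where "strict_mono r" "\<eta> > 0"
    "\<And>j w. strict_mono j \<Longrightarrow> dist w y < \<eta> \<Longrightarrow>
       (\<lambda>k. int_iterate f (n (r (j k)) - n (r k)) w) \<longlonglongrightarrow> w"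
proof -
  let ?f = "int_iterate f"
  obtain V r h where V: "open V" "x \<in> V" and r: "strict_mono (r :: nat \<Rightarrow> nat)"
    and conv: "converges_compactly_on V ((\<lambda>k. ?f (n k)) \<circ> r) h"
    using fatou_set_is_largest(2)[of f] x unfolding normal_family_on_def
    by (metis (no_types, lifting) image_subset_iff rangeI)
  obtain e where e: "e > 0" "cball x e \<subseteq> V"
    using V open_contains_cball by blast
  have unif: "uniform_limit (cball x e) ((\<lambda>k. ?f (n k)) \<circ> r) h sequentially"
    using conv e compact_cball_compact_space[OF comp] by (auto simp: converges_compactly_on_def)
  obtain \<eta> where \<eta>: "\<eta> > 0" "\<And>i w. dist w y < \<eta> \<Longrightarrow> dist (?f i w) (?f i y) < e / 2"
    using equicontinuous_atE[OF eq, of "e / 2"] e by auto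
  have limr: "(\<lambda>k. ?f (n (r k)) x) \<longlonglongrightarrow> y"
    using LIMSEQ_subseq_LIMSEQ[OF lim r] by (simp add: o_def)
  have near: "\<forall>\<^sub>F k in sequentially. dist (?f (- n (r k)) w) x < e" if w: "dist w y < \<eta>" for w
  proof -
    have "\<forall>\<^sub>F k in sequentially. dist (?f (n (r k)) x) y < \<eta>"
      using limr \<eta>(1) by (rule tendstoD)
    then show ?thesis
    proof eventually_elim
      case (elim k)
      \<comment> \<open>The inverse iterate is applied to \<open>?f (n (r k)) x\<close>, which is
        close to \<open>y\<close> and is sent back exactly to \<open>x\<close>. The other half of
        \<open>e\<close> covers the passage from \<open>y\<close> to \<open>w\<close>.\<close>
      have "dist (?f (- n (r k)) (?f (n (r k)) x)) (?f (- n (r k)) y) < e / 2"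
        using \<eta>(2)[OF elim] .
      then have "dist x (?f (- n (r k)) y) < e / 2"
        by (simp add: int_iterate_cancel[OF \<open>bij f\<close>])
      then show ?case
        using \<eta>(2)[OF w, of "- n (r k)"] dist_triangle[of "?f (- n (r k)) w" x "?f (- n (r k)) y"]
        by (simp add: dist_commute)
    qed
  qed
  \<comment> \<open>Any strictly increasing \<open>j\<close> works, since both sequences of iterates
    have the same uniform limit \<open>h\<close> near \<open>x\<close>; this leaves \<open>j\<close>
    free to be chosen for divergence of the exponents.\<close>
  have "(\<lambda>k. ?f (n (r (j k)) - n (r k)) w) \<longlonglongrightarrow> w"
    if j: "strict_mono j" and w: "dist w y < \<eta>" for j :: "nat \<Rightarrow> nat" and w
  proof (rule tendstoI)
    fix \<epsilon> :: real assume "\<epsilon> > 0"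
    then have ev: "\<forall>\<^sub>F k in sequentially. \<forall>u\<in>cball x e. dist (?f (n (r k)) u) (h u) < \<epsilon> / 2"
      using uniform_limitD[OF unif, of "\<epsilon> / 2"] by simp
    moreover have "\<forall>\<^sub>F k in sequentially. \<forall>u\<in>cball x e. dist (?f (n (r (j k))) u) (h u) < \<epsilon> / 2"
      using eventually_subseq[OF j ev] .
    ultimately show "\<forall>\<^sub>F k in sequentially. dist (?f (n (r (j k)) - n (r k)) w) w < \<epsilon>"
      using near[OF w]
    proof eventually_elim
      case (elim k)
      let ?u = "?f (- n (r k)) w"
      have "?u \<in> cball x e" using elim(3) by (simp add: dist_commute)
      then have "dist (?f (n (r (j k))) ?u) (?f (n (r k)) ?u) < \<epsilon>"
        using elim(1,2) dist_triangle_half_l[of _ "h ?u" \<epsilon> ] by (simp add: dist_commute)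
      then show ?case
        using int_iterate_add[OF \<open>bij f\<close>, of "n (r (j k))" "- n (r k)" w]
        by (simp add: int_iterate_cancel[OF \<open>bij f\<close>])
    qed
  qed
  with r \<eta>(1) that show thesis by blast
qed

section \<open>Integer sequences with divergent differences\<close>

lemma subsequence_of_growing_gaps:
  fixes n :: "nat \<Rightarrow> int"
  assumes "filterlim n at_top sequentially"
  obtains j where "strict_mono (j :: nat \<Rightarrow> nat)" "\<And>k. n (j k) \<ge> n k + int k"
proof -
  have "\<exists>i'>i. n i' \<ge> n (Suc k) + int (Suc k)" for i k
  proof -
    have "\<forall>\<^sub>F i' in sequentially. i < i' \<and> n (Suc k) + int (Suc k) \<le> n i'"
      using assms unfolding filterlim_at_top
      by (intro eventually_conj eventually_gt_at_top) blast
    then show ?thesis by (auto simp: eventually_sequentially)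
  qed
  \<comment> \<open>The recursive choice can start at index 0, where the required gap is 0.\<close>
  then obtain j where "\<And>k. n (j k) \<ge> n k + int k" "\<And>k. j k < j (Suc k)"
    using dependent_nat_choice[of "\<lambda>k i. n i \<ge> n k + int k" "\<lambda>k i i'. i < i'"]
    by (metis add.right_neutral int_ops(1) order_refl)
  then show thesis using that[of j] by (simp add: strict_mono_Suc_iff)
qed

lemma filterlim_at_bot_iff_uminus_int:
  fixes n :: "'b \<Rightarrow> int"
  shows "filterlim n at_bot F \<longleftrightarrow> filterlim (\<lambda>k. - n k) at_top F"
proof -
  have "(\<forall>Z. P Z) \<longleftrightarrow> (\<forall>Z. P (- Z))" for P :: "int \<Rightarrow> bool"
    by (metis minus_minus)
  from this[of "\<lambda>Z. \<forall>\<^sub>F k in F. n k \<le> Z"] show ?thesis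
    by (simp add: filterlim_at_top filterlim_at_bot le_minus_iff)
qed

text \<open>Divergence of \<open>n\<close> alone does not make arbitrary differences diverge, so
  \<open>j k\<close> is taken late enough to force a gap of at least \<open>k\<close>. The case of
  minus infinity follows by negating \<open>n\<close>.\<close>

lemma tends_to_pm_infinity_differences:
  assumes "tends_to_pm_infinity n"
  obtains j where "strict_mono (j :: nat \<Rightarrow> nat)" "tends_to_pm_infinity (\<lambda>k. n (j k) - n k)"
proof -
  have int: "filterlim (\<lambda>k::nat. int k) at_top sequentially"
    by (rule filterlim_int_sequentially)
  show thesis
  proof (cases "filterlim n at_top sequentially")
    case True
    then obtain j where "strict_mono (j :: nat \<Rightarrow> nat)" and j: "\<And>k. n (j k) \<ge> n k + int k"
      using subsequence_of_growing_gaps by blast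
    moreover have "filterlim (\<lambda>k. n (j k) - n k) at_top sequentially"
      using j by (intro filterlim_at_top_mono[OF int] always_eventually) (simp add: algebra_simps)
    ultimately show thesis using that by (simp add: tends_to_pm_infinity_def)
  next
    case False
    then have "filterlim (\<lambda>k. - n k) at_top sequentially"
      using assms by (simp add: tends_to_pm_infinity_def filterlim_at_bot_iff_uminus_int)
    then obtain j where "strict_mono (j :: nat \<Rightarrow> nat)" and j: "\<And>k. - n (j k) \<ge> - n k + int k"
      using subsequence_of_growing_gaps by blast
    moreover have "filterlim (\<lambda>k. - (n (j k) - n k)) at_top sequentially"
    proof (intro filterlim_at_top_mono[OF int] always_eventually allI)
      show "int k \<le> - (n (j k) - n k)" for k using j[of k] by simp
    qed
    ultimately show thesis using that by (simp add: tends_to_pm_infinity_def filterlim_at_bot_iff_uminus_int)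
  qed
qed


section \<open>Propagation of the convergence to the identity\<close>

text \<open>Equicontinuity first gives convergence at \<open>z\<close>, then keeps the late iterates
  of a neighbourhood inside one chart. There they are bounded holomorphic maps on a ball, tending to
  the identity on a nonempty open part, so the continuation lemma applies.\<close>

lemma tendsto_ident_interior_closed_in_fatou:
  fixes A :: "('a::metric_space, 'n::finite) chart set"
  assumes A: "complex_atlas A" and comp: "compact (UNIV :: 'a set)" and aut: "automorphism A f"
    and z: "z \<in> fatou_set f"
    and clos: "z \<in> closure (interior {w. (\<lambda>k. int_iterate f (m k) w) \<longlonglongrightarrow> w})"
  shows "z \<in> interior {w. (\<lambda>k. int_iterate f (m k) w) \<longlonglongrightarrow> w}"
proof -
  let ?f = "int_iterate f"
  let ?E = "{w. (\<lambda>k. ?f (m k) w) \<longlonglongrightarrow> w}"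
  have eq: "equicontinuous_at ?f z"
    using fatou_equicontinuous_at[OF A comp aut z] .
  have "(\<lambda>k. ?f (m k) z) \<longlonglongrightarrow> z"
    using clos closure_mono[OF interior_subset] by (intro equicontinuous_tendsto_ident_closed[OF eq]) blast
  obtain c where c: "c \<in> A" "z \<in> fst c" using chart_exists[OF A] by blast
  let ?\<phi> = "snd c" and ?\<psi> = "chart_inv c"
  have cont: "continuous_on (fst c) ?\<phi>" "continuous_on (chart_image c) ?\<psi>"
    using chart_homeomorphism[OF A c(1)] by (auto simp: homeomorphism_def)
  \<comment> \<open>Staying in this set serves two purposes: images remain in the chart domain, and
    their coordinates are bounded. The radius 1 is arbitrary.\<close>
  have "open (fst c \<inter> ?\<phi> -` ball (?\<phi> z) 1)"
    using continuous_open_preimage[OF cont(1)] chart_open[OF A c(1)] by simp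
  moreover have "z \<in> fst c \<inter> ?\<phi> -` ball (?\<phi> z) 1" using c by simp
  ultimately obtain \<epsilon> where \<epsilon>: "\<epsilon> > 0" "ball z \<epsilon> \<subseteq> fst c \<inter> ?\<phi> -` ball (?\<phi> z) 1"
    using open_contains_ball by blast
  obtain \<delta> where \<delta>: "\<delta> > 0" "\<And>i w. dist w z < \<delta> \<Longrightarrow> dist (?f i w) (?f i z) < \<epsilon> / 2"
    using equicontinuous_atE[OF eq, of "\<epsilon> / 2"] \<epsilon> by auto
  \<comment> \<open>The metric ball of radius \<delta> is traded for a coordinate ball of radius
    \<rho>, the domain on which the continuation lemma works.\<close>
  have "open {u \<in> chart_image c. ?\<psi> u \<in> ball z \<delta>}"
    by (rule open_chart_inv_vimage[OF A c(1) open_ball])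
  moreover have "?\<phi> z \<in> {u \<in> chart_image c. ?\<psi> u \<in> ball z \<delta>}"
    using c \<delta> by (simp add: chart_inv_chart[OF A] chart_image_def)
  ultimately obtain \<rho> where \<rho>: "\<rho> > 0" "ball (?\<phi> z) \<rho> \<subseteq> {u \<in> chart_image c. ?\<psi> u \<in> ball z \<delta>}"
    using open_contains_ball by blast
  define N where "N = fst c \<inter> ?\<phi> -` ball (?\<phi> z) \<rho>"
  have N: "open N" "z \<in> N"
    using continuous_open_preimage[OF cont(1)] chart_open[OF A c(1)] c \<rho> by (simp_all add: N_def)
  \<comment> \<open>Dropping the first \<open>k0\<close> terms makes the bounds below hold for every
    index.\<close>
  obtain k0 where k0: "\<And>k. k \<ge> k0 \<Longrightarrow> dist (?f (m k) z) z < \<epsilon> / 2"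
    using tendstoD[OF \<open>(\<lambda>k. ?f (m k) z) \<longlonglongrightarrow> z\<close>, of "\<epsilon> / 2"] \<epsilon>
    by (auto simp: eventually_sequentially)
  have inside: "?f (m (k + k0)) w \<in> ball z \<epsilon>" if "w \<in> ball z \<delta>" for k w
    using \<delta>(2)[of w "m (k + k0)"] k0[of "k + k0"] that
      dist_triangle[of "?f (m (k + k0)) w" z "?f (m (k + k0)) z"]
    by (simp add: dist_commute)
  define F where "F k = coord_rep (?f (m (k + k0))) c c" for k
  have F_lim_iff: "(\<lambda>k. F k (?\<phi> w)) \<longlonglongrightarrow> ?\<phi> w \<longleftrightarrow> (\<lambda>k. ?f (m k) w) \<longlonglongrightarrow> w" if "w \<in> N" for w
  proof -
    have w: "w \<in> fst c" "w \<in> ball z \<delta>" "?\<phi> w \<in> chart_image c"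
      using that \<rho>(2) chart_inv_chart[OF A c(1), of w] by (auto simp: N_def)
    have F: "F k (?\<phi> w) = ?\<phi> (?f (m (k + k0)) w)" for k
      using w by (simp add: F_def coord_rep_def chart_inv_chart[OF A c(1)])
    have f: "?f (m (k + k0)) w \<in> fst c" for k
      using inside[OF w(2)] \<epsilon>(2) by blast
    have "(\<lambda>k. F k (?\<phi> w)) \<longlonglongrightarrow> ?\<phi> w \<longleftrightarrow> (\<lambda>k. ?f (m (k + k0)) w) \<longlonglongrightarrow> w"
    proof
      assume "(\<lambda>k. F k (?\<phi> w)) \<longlonglongrightarrow> ?\<phi> w"
      then have "(\<lambda>k. ?\<psi> (F k (?\<phi> w))) \<longlonglongrightarrow> ?\<psi> (?\<phi> w)"
        using w f by (intro continuous_on_tendsto_compose[OF cont(2)]) (auto simp: F chart_image_def)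
      then show "(\<lambda>k. ?f (m (k + k0)) w) \<longlonglongrightarrow> w"
        using w f by (simp add: F chart_inv_chart[OF A c(1)])
    next
      assume "(\<lambda>k. ?f (m (k + k0)) w) \<longlonglongrightarrow> w"
      then show "(\<lambda>k. F k (?\<phi> w)) \<longlonglongrightarrow> ?\<phi> w"
        unfolding F using w f by (intro continuous_on_tendsto_compose[OF cont(1)]) auto
    qed
    also have "\<dots> \<longleftrightarrow> (\<lambda>k. ?f (m k) w) \<longlonglongrightarrow> w"
      by (rule iffI[OF LIMSEQ_offset LIMSEQ_ignore_initial_segment])
    finally show ?thesis .
  qed
  have \<psi>N: "?\<psi> u \<in> N" "?\<phi> (?\<psi> u) = u" if "u \<in> ball (?\<phi> z) \<rho>" for u
    using that \<rho>(2) chart_chart_inv[OF A c(1), of u] by (auto simp: N_def)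
  have ballE: "?\<psi> u \<in> ball z \<delta>" if "u \<in> ball (?\<phi> z) \<rho>" for u
    using that \<rho>(2) by blast
  \<comment> \<open>The part of the coordinate ball where convergence is already known; it is
    nonempty because the neighbourhood \<open>N\<close> of \<open>z\<close> meets the interior of
    \<open>?E\<close>.\<close>
  define U where "U = ball (?\<phi> z) \<rho> \<inter> {u \<in> chart_image c. ?\<psi> u \<in> interior ?E}"
  have "N \<subseteq> ?E"
  proof
    fix w assume w: "w \<in> N"
    have "(\<lambda>k. F k (?\<phi> w)) \<longlonglongrightarrow> ?\<phi> w"
    proof (rule holomorphic_vec_tendsto_ident_continuation)
      show "holomorphic_vec_on (F k) (ball (?\<phi> z) \<rho>)" for k
      proof -
        have "ball (?\<phi> z) \<rho> \<subseteq> coord_dom (?f (m (k + k0))) c c"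
        proof
          fix u assume u: "u \<in> ball (?\<phi> z) \<rho>"
          then show "u \<in> coord_dom (?f (m (k + k0))) c c"
            using inside[OF ballE[OF u], of k] \<epsilon>(2) \<rho>(2) by (auto simp: coord_dom_eq[OF A c(1)])
        qed
        then show ?thesis
          using holomorphic_map_int_iterate[OF A aut, of "m (k + k0)"] c(1)
            holomorphic_vec_on_subset
          unfolding F_def holomorphic_map_def by blast
      qed
      show "norm (F k u) \<le> norm (?\<phi> z) + 1" if "u \<in> ball (?\<phi> z) \<rho>" for k u
      proof -
        have "F k u \<in> ball (?\<phi> z) 1"
          using inside[OF ballE[OF that], of k] \<epsilon>(2) unfolding F_def coord_rep_def by blast
        then show ?thesis
          using norm_triangle_sub[of "F k u" "?\<phi> z"] by (simp add: dist_norm norm_minus_commute)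
      qed
      show "open U"
        unfolding U_def using open_chart_inv_vimage[OF A c(1) open_interior] by blast
      show "U \<subseteq> ball (?\<phi> z) \<rho>" by (simp add: U_def)
      show "U \<noteq> {}"
      proof -
        obtain v where v: "v \<in> N" "v \<in> interior ?E"
          using open_Int_closure_eq_empty[OF N(1), of "interior ?E"] clos N(2) by blast
        then have "?\<phi> v \<in> U"
          by (auto simp: U_def N_def chart_inv_chart[OF A c(1)] chart_image_def)
        then show ?thesis by blast
      qed
      show "(\<lambda>k. F k u) \<longlonglongrightarrow> u" if "u \<in> U" for u
      proof -
        have "u \<in> ball (?\<phi> z) \<rho>" "?\<psi> u \<in> ?E"
          using that interior_subset unfolding U_def by blast+
        then show ?thesis
          using F_lim_iff[of "?\<psi> u"] \<psi>N[of u] by simp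
      qed
      show "?\<phi> w \<in> ball (?\<phi> z) \<rho>" using w by (simp add: N_def)
    qed
    then show "w \<in> ?E" using F_lim_iff[OF w] by simp
  qed
  then show ?thesis using N by (meson interiorI)
qed

theorem mainTheorem6:
  fixes A :: "('a::metric_space, 2) chart set"
    and f :: "'a \<Rightarrow> 'a"
    and \<Omega> :: "'a set"
  assumes "compact_kahler_surface A"
    and "automorphism A f"
    and "loxodromic A f"
    and "\<Omega> \<in> components (fatou_set f)"
    and "\<exists>x\<in>\<Omega>. \<exists>y\<in>\<Omega>. \<exists>n. tends_to_pm_infinity n \<and>
           (\<lambda>k. int_iterate f (n k) x) \<longlonglongrightarrow> y"
  shows "rotation_domain f \<Omega>"
proof -
  have A: "complex_atlas A" and comp: "compact (UNIV :: 'a set)"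
    using assms(1) by (auto simp: compact_kahler_surface_def)
  have "bij f" using assms(2) by (simp add: automorphism_def)
  have \<Omega>: "\<Omega> \<subseteq> fatou_set f" "connected \<Omega>"
    using assms(4) in_components_subset in_components_connected by auto
  have eq: "equicontinuous_at (int_iterate f) z" if "z \<in> \<Omega>" for z
    using fatou_equicontinuous_at[OF A comp assms(2)] that \<Omega> by blast
  obtain x y n where x: "x \<in> \<Omega>" and y: "y \<in> \<Omega>" and n: "tends_to_pm_infinity n"
    and lim: "(\<lambda>k. int_iterate f (n k) x) \<longlonglongrightarrow> y"
    using assms(5) by blast
  have "x \<in> fatou_set f" using x \<Omega> by blast
  then obtain r :: "nat \<Rightarrow> nat" and \<eta> where r: "strict_mono r" and \<eta>: "\<eta> > 0"
    and conv: "\<And>j w. strict_mono j \<Longrightarrow> dist w y < \<eta> \<Longrightarrow>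
       (\<lambda>k. int_iterate f (n (r (j k)) - n (r k)) w) \<longlonglongrightarrow> w"
    using recurrent_differences[OF comp \<open>bij f\<close> _ eq[OF y] lim] by blast
  \<comment> \<open>The recurrence argument has already fixed the subsequence \<open>r\<close>, so
    the growing gaps are chosen within \<open>n (r k)\<close>.\<close>
  have "tends_to_pm_infinity (\<lambda>k. n (r k))"
    using n filterlim_compose[OF _ filterlim_subseq[OF r]] unfolding tends_to_pm_infinity_def by blast
  then obtain j where j: "strict_mono (j :: nat \<Rightarrow> nat)"
    "tends_to_pm_infinity (\<lambda>k. n (r (j k)) - n (r k))"
    using tends_to_pm_infinity_differences by blast
  define m where "m k = n (r (j k)) - n (r k)" for k
  define S where "S = interior {w. (\<lambda>k. int_iterate f (m k) w) \<longlonglongrightarrow> w}"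
  have "ball y \<eta> \<subseteq> {w. (\<lambda>k. int_iterate f (m k) w) \<longlonglongrightarrow> w}"
    using conv[OF j(1)] by (auto simp: m_def dist_commute)
  then have "y \<in> S"
    unfolding S_def using \<eta> by (meson centre_in_ball interiorI open_ball)
  have "S \<inter> \<Omega> = {} \<or> \<Omega> \<subseteq> S"
  proof -
    \<comment> \<open>Relative closedness lets the disjoint open sets \<open>S\<close> and
      \<open>- closure S\<close> cover \<Omega>, so connectedness puts \<Omega> inside one of
      them.\<close>
    have "\<Omega> \<inter> closure S \<subseteq> S"
      unfolding S_def using tendsto_ident_interior_closed_in_fatou[OF A comp assms(2)] \<Omega> by blast
    then have "\<Omega> \<subseteq> S \<union> - closure S" "S \<inter> - closure S \<inter> \<Omega> = {}"
      using closure_subset by blast+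
    then show ?thesis
      using connectedD[OF \<Omega>(2), of S "- closure S"] by (auto simp: S_def)
  qed
  then have "\<Omega> \<subseteq> S" using y \<open>y \<in> S\<close> by blast
  then have "(\<lambda>k. int_iterate f (m k) z) \<longlonglongrightarrow> z" if "z \<in> \<Omega>" for z
    using that interior_subset unfolding S_def by blast
  then have "uniform_limit K (\<lambda>k. int_iterate f (m k)) (\<lambda>z. z) sequentially"
    if "compact K" "K \<subseteq> \<Omega>" for K
    using that eq by (intro equicontinuous_tendsto_ident_uniform) blast+
  then show ?thesis
    using j(2) unfolding rotation_domain_def converges_compactly_on_def m_def by blast
qed

end
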